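(* For every $n \geq 0$, the number of Dyck paths of semilength $n$ whose peak heights avoid the set $\{2r+3 \mid r \geq 0\}$ (that is, no peak has height in $\{3,5,7,\dots\}$) and whose up-runs all have length at most $3$ equals $G_{n+1}$, where $(G_n)_{n\ge 0}$ is the sequence of generalized Catalan numbers defined by $G_0 = 1$, $G_1 = 1$, and $$G_{n+2} = G_{n+1} + \sum_{1 \leq k < n+1} G_k G_{n-k} \qquad (n \geq 0).$$
   Context: A Dyck path is a finite (possibly empty) word in the letters $U$ (standing for $+1$) and $D$ (standing for $-1$) whose partial sums are all nonnegative and whose total sum is $0$. A Dyck path of length $2n$ is said to have semilength $n$. The height of a path at position $k$ is the sum of its first $k$ terms. A peak at height $h$ is an occurrence of two consecutive steps $UD$ such that the height of the path right after the $U$ is $h$; by convention the empty path has a peak at height $0$. An up-run of length $\ell$ is a block of $\ell$ consecutive $U$'s that is neither preceded nor followed by a $U$ (a maximal block of $U$'s). *)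

theory Defs imports Main begin

datatype step = U | D

fun step_val :: "step \<Rightarrow> int" where
  "step_val U = 1"
| "step_val D = -1"

definition height :: "step list \<Rightarrow> nat \<Rightarrow> int" where
  "height w k = sum_list (map step_val (take k w))"

definition dyck_path :: "step list \<Rightarrow> bool" where
  "dyck_path w \<longleftrightarrow> (\<forall>k \<le> length w. 0 \<le> height w k) \<and> height w (length w) = 0"

definition dyck_paths :: "nat \<Rightarrow> step list set" where
  "dyck_paths n = {w. dyck_path w \<and> length w = 2 * n}"

(* The empty path has, by convention, a peak at height 0. *)
definition peak_heights :: "step list \<Rightarrow> int set" where
  "peak_heights w =
     (if w = [] then {0}
      else {height w (length u + 1) | u v. w = u @ [U, D] @ v})"

definition up_run_lengths :: "step list \<Rightarrow> nat set" where
  "up_run_lengths w =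
     {l. 0 < l \<and> (\<exists>u v. w = u @ replicate l U @ v \<and>
            (u = [] \<or> last u \<noteq> U) \<and> (v = [] \<or> hd v \<noteq> U))}"

fun gen_catalan :: "nat \<Rightarrow> nat" where
  "gen_catalan 0 = 1"
| "gen_catalan (Suc 0) = 1"
| "gen_catalan (Suc (Suc n)) =
     gen_catalan (Suc n) + (\<Sum>k\<in>{1..<n+1}. gen_catalan k * gen_catalan (n - k))"

end

theory Submission
  imports Defs "HOL-Computational_Algebra.Formal_Power_Series"
begin

text \<open>
  By first-return decomposition, Dyck paths are binary trees, with \<open>Node l r\<close> standing for
  \<open>U l D r\<close>. Let \<open>F h k\<close> be the generating function of the paths that start at level \<open>h\<close>, obey
  the restrictions on peaks and up-runs, and whose initial up-run has length at most \<open>k\<close>.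
  The decomposition gives
  \<open>F h (k + 1) = 1 + x (F (h + 1) k - [h + 1 is forbidden]) F h 3\<close> and \<open>F h 0 = 1\<close>, and
  \<open>F 3 k = F 1 k\<close> because the restrictions are 2-periodic above level 1. Eliminating, \<open>Q = F 1 3\<close>
  satisfies \<open>Q = 1 + (x - x^2) Q + x^2 Q^2\<close>, which determines the generating function \<open>G\<close> of the
  generalized Catalan numbers; and \<open>F 0 3 = 1 / (1 - x - x^2 Q)\<close>, whence \<open>1 + x F 0 3 = G\<close>.
\<close>

section \<open>Dyck paths as binary trees\<close>

datatype dtree = Leaf | Node dtree dtree

fun nodes :: "dtree \<Rightarrow> nat" where
  "nodes Leaf = 0"
| "nodes (Node l r) = Suc (nodes l + nodes r)"

fun word :: "dtree \<Rightarrow> step list" where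
  "word Leaf = []"
| "word (Node l r) = U # word l @ D # word r"

lemma length_word: "length (word t) = 2 * nodes t"
  by (induction t) auto

lemma word_eq_Nil_iff [simp]: "word t = [] \<longleftrightarrow> t = Leaf"
  by (cases t) auto

lemma total_word: "sum_list (map step_val (word t)) = 0"
  by (induction t) auto

lemma height_Cons_Suc: "height (x # w) (Suc k) = step_val x + height w k"
  by (simp add: height_def)

lemma height_append:
  "height (u @ v) k = (if k \<le> length u then height u k
     else sum_list (map step_val u) + height v (k - length u))"
  by (simp add: height_def)

lemma height_word_nonneg: "0 \<le> height (word t) k"
proof (induction t arbitrary: k)
  case Leaf
  show ?case by (simp add: height_def)
next
  case (Node l r)
  show ?case
  proof (cases k)
    case 0
    then show ?thesis by (simp add: height_def)
  next
    case (Suc j)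
    have "0 \<le> 1 + height (word l @ D # word r) j"
    proof (cases "j \<le> length (word l)")
      case True
      then show ?thesis using Node.IH(1)[of j] by (simp add: height_append)
    next
      case False
      then obtain i where "j - length (word l) = Suc i"
        by (metis Suc_diff_Suc not_le)
      then show ?thesis using False Node.IH(2)[of i]
        by (simp add: height_append total_word height_Cons_Suc)
    qed
    then show ?thesis by (simp add: Suc height_Cons_Suc)
  qed
qed

lemma dyck_path_word: "dyck_path (word t)"
  by (simp add: dyck_path_def height_word_nonneg) (simp add: height_def total_word)

text \<open>Unique readability: the word of a tree ends where the remainder is empty or starts with
  a step below the starting level. The suffixes are needed for the induction, because the left
  subtree is followed by \<open>D\<close>.\<close>

lemma word_append_inject:
  assumes "word t @ v = word t' @ v'"
    and "v = [] \<or> hd v = D" and "v' = [] \<or> hd v' = D"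
  shows "t = t' \<and> v = v'"
  using assms
proof (induction t arbitrary: t' v v')
  case Leaf
  then show ?case by (cases t') auto
next
  case (Node l r)
  show ?case
  proof (cases t')
    case Leaf
    then show ?thesis using Node.prems by auto
  next
    case t': (Node l' r')
    have "word l @ (D # word r @ v) = word l' @ (D # word r' @ v')"
      using Node.prems(1) t' by simp
    from Node.IH(1)[OF this] have "l = l'" "word r @ v = word r' @ v'" by auto
    then show ?thesis using Node.IH(2)[of v r' v'] Node.prems t' by auto
  qed
qed

lemma inj_word: "inj word"
  by (rule injI) (metis word_append_inject append_Nil2)

text \<open>A greedy parser: it can stop only at the end of the word or at a \<open>D\<close>
  leaving the starting level downwards. The bound on the total rules out an unmatched
  \<open>U\<close>.\<close>

lemma word_prefix_exists:
  assumes "sum_list (map step_val w) \<le> 0"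
  shows "\<exists>t. w = word t \<or> (\<exists>v. w = word t @ D # v)"
  using assms
proof (induction w rule: length_induct)
  case (1 w)
  show ?case
  proof (cases w)
    case Nil
    then have "w = word Leaf" by simp
    then show ?thesis by blast
  next
    case (Cons x w')
    show ?thesis
    proof (cases x)
      case D
      then have "w = word Leaf @ D # w'" using Cons by simp
      then show ?thesis by blast
    next
      case U
      then have neg: "sum_list (map step_val w') \<le> -1" using "1.prems" Cons by simp
      then obtain l where l: "w' = word l \<or> (\<exists>v. w' = word l @ D # v)"
        using "1.IH" Cons by force
      \<comment> \<open>The word of a tree has total 0 but \<open>w'\<close> has a negative one, so
        the \<open>D\<close> matching the first \<open>U\<close> exists.\<close>
      then obtain v where v: "w' = word l @ D # v"
        using neg total_word[of l] by auto
      then have "sum_list (map step_val v) \<le> 0" using neg by (simp add: total_word)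
      then obtain r where "v = word r \<or> (\<exists>v'. v = word r @ D # v')"
        using "1.IH" Cons v by force
      then have "w = word (Node l r) \<or> (\<exists>v'. w = word (Node l r) @ D # v')"
        using Cons U v by auto
      then show ?thesis by blast
    qed
  qed
qed

lemma dyck_path_imp_word:
  assumes "dyck_path w"
  shows "\<exists>t. w = word t"
proof -
  have "sum_list (map step_val w) \<le> 0"
    using assms by (simp add: dyck_path_def height_def)
  then obtain t where t: "w = word t \<or> (\<exists>v. w = word t @ D # v)"
    using word_prefix_exists by blast
  have False if v: "w = word t @ D # v" for v
  proof -
    have "height w (Suc (length (word t))) = -1"
      by (simp add: v height_def total_word)
    moreover have "0 \<le> height w (Suc (length (word t)))"
      using assms by (simp add: dyck_path_def v)
    ultimately show False by simp
  qed
  then show ?thesis using t by blast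
qed

lemma dyck_paths_eq: "dyck_paths n = word ` {t. nodes t = n}"
  using dyck_path_imp_word dyck_path_word
  by (fastforce simp: dyck_paths_def length_word)

section \<open>Reading off peaks and up-runs\<close>

text \<open>Unlike \<^const>\<open>peak_heights\<close>, this starts at level \<open>h\<close> and does not
  treat the empty word specially.\<close>

definition peaks :: "int \<Rightarrow> step list \<Rightarrow> int set" where
  "peaks h w = {h + height w (length u + 1) | u v. w = u @ [U, D] @ v}"

lemma peaks_Nil [simp]: "peaks h [] = {}"
  by (simp add: peaks_def)

lemma peaks_Cons:
  "peaks h (x # w) = (if x = U \<and> w \<noteq> [] \<and> hd w = D then {h + 1} else {})
     \<union> peaks (h + step_val x) w"
    (is "?L = ?A \<union> ?B")
proof (intro equalityI subsetI)
  fix p assume "p \<in> ?L"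
  then obtain u v where p: "p = h + height (x # w) (length u + 1)"
    and w: "x # w = u @ [U, D] @ v" by (auto simp: peaks_def)
  show "p \<in> ?A \<union> ?B"
  proof (cases u)
    case Nil
    then show ?thesis using p w by (simp add: height_def)
  next
    case (Cons y u')
    then have "p = h + step_val x + height w (length u' + 1)" "w = u' @ [U, D] @ v"
      using p w by (simp_all add: height_Cons_Suc)
    then show ?thesis unfolding peaks_def by blast
  qed
next
  fix p assume "p \<in> ?A \<union> ?B"
  then show "p \<in> ?L"
  proof
    assume "p \<in> ?A"
    then have "x # w = [] @ [U, D] @ tl w" "p = h + height (x # w) (length [] + 1)"
      by (cases w; auto simp: height_def split: if_splits)+
    then show ?thesis unfolding peaks_def by blast
  next
    assume "p \<in> ?B"
    then obtain u v where "p = h + step_val x + height w (length u + 1)"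
      and "w = u @ [U, D] @ v" by (auto simp: peaks_def)
    then have "p = h + height (x # w) (length (x # u) + 1)" "x # w = (x # u) @ [U, D] @ v"
      by (simp_all add: height_Cons_Suc)
    then show ?thesis unfolding peaks_def by blast
  qed
qed

lemma peak_heights_eq: "peak_heights w = (if w = [] then {0} else peaks 0 w)"
  by (simp add: peak_heights_def peaks_def)

text \<open>The initial up-run has length at most \<open>k\<close>, every later one at most 3.\<close>

fun short_runs :: "nat \<Rightarrow> step list \<Rightarrow> bool" where
  "short_runs k [] = True"
| "short_runs k (D # w) = short_runs 3 w"
| "short_runs 0 (U # w) = False"
| "short_runs (Suc k) (U # w) = short_runs k w"

lemma short_runs_replicate:
  "short_runs k (replicate l U @ v) \<longleftrightarrow> l \<le> k \<and> short_runs (k - l) v"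
proof (induction l arbitrary: k)
  case 0
  show ?case by simp
next
  case (Suc l)
  then show ?case by (cases k) auto
qed

lemma split_initial_run: "\<exists>l v. w = replicate l U @ v \<and> (v = [] \<or> hd v \<noteq> U)"
proof (induction w)
  case Nil
  show ?case by simp
next
  case (Cons x w)
  then obtain l v where lv: "w = replicate l U @ v" "v = [] \<or> hd v \<noteq> U" by blast
  show ?case
  proof (cases x)
    case U
    then have "x # w = replicate (Suc l) U @ v" using lv by simp
    then show ?thesis using lv by blast
  next
    case D
    then have "x # w = replicate 0 U @ (x # w)" "hd (x # w) \<noteq> U" by simp_all
    then show ?thesis by blast
  qed
qed

text \<open>Along the prefix before the run, the budget falls with each \<open>U\<close> and is
  reset to 3 by each \<open>D\<close>, so it never exceeds 3 when the run begins.\<close>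

lemma up_run_lengths_short:
  assumes "short_runs k w" "k \<le> 3" "l \<in> up_run_lengths w"
  shows "l \<le> 3"
proof -
  obtain u v where w: "w = u @ replicate l U @ v"
    using assms(3) by (auto simp: up_run_lengths_def)
  have "l \<le> 3" if "short_runs k (u @ replicate l U @ v)" "k \<le> 3"
    using that
  proof (induction k u rule: short_runs.induct)
    case (1 k)
    then show ?case by (simp add: short_runs_replicate)
  qed auto
  then show ?thesis using assms(1,2) w by simp
qed

lemma short_runs_if_up_run_lengths:
  assumes "\<And>l. l \<in> up_run_lengths w \<Longrightarrow> l \<le> 3"
  shows "short_runs 3 w"
  using assms
proof (induction w rule: length_induct)
  case (1 w)
  obtain l v where w: "w = replicate l U @ v" and v: "v = [] \<or> hd v \<noteq> U"
    using split_initial_run by blast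
  have "l \<le> 3"
  proof (cases "l = 0")
    case False
    then have "l \<in> up_run_lengths w"
      unfolding up_run_lengths_def using w v by (force intro: exI[of _ "[]"])
    then show ?thesis by (rule "1.prems")
  qed simp
  moreover have "short_runs (3 - l) v"
  proof (cases v)
    case Nil
    then show ?thesis by simp
  next
    case (Cons x v')
    then have x: "x = D" using v by (cases x) auto
    have "m \<le> 3" if m: "m \<in> up_run_lengths v'" for m
    proof -
      obtain a b where ab: "0 < m" "v' = a @ replicate m U @ b"
        "a = [] \<or> last a \<noteq> U" "b = [] \<or> hd b \<noteq> U"
        using m unfolding up_run_lengths_def by blast
      \<comment> \<open>The separating \<open>D\<close> keeps runs of \<open>v'\<close> maximal in
        \<open>w\<close>, even when \<open>a\<close> is empty.\<close>
      let ?a = "replicate l U @ D # a"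
      have "w = ?a @ replicate m U @ b" "last ?a \<noteq> U"
        using ab Cons x w by auto
      then have "m \<in> up_run_lengths w"
        unfolding up_run_lengths_def using ab by blast
      then show ?thesis by (rule "1.prems")
    qed
    then have "short_runs 3 v'" using "1.IH" w Cons by simp
    then show ?thesis using Cons x by simp
  qed
  ultimately show ?case by (simp add: w short_runs_replicate)
qed

lemma up_run_lengths_le_3_iff: "(\<forall>l \<in> up_run_lengths w. l \<le> 3) \<longleftrightarrow> short_runs 3 w"
  using up_run_lengths_short[of 3] short_runs_if_up_run_lengths by blast

section \<open>The restrictions on trees\<close>

definition forbidden :: "nat \<Rightarrow> bool" where
  "forbidden h \<longleftrightarrow> odd h \<and> 3 \<le> h"

lemma forbidden_iff: "forbidden h \<longleftrightarrow> int h \<in> {2 * int r + 3 | r. 0 \<le> r}"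
proof
  assume "forbidden h"
  then obtain m where "h = 2 * m + 1" "1 \<le> m"
    by (auto simp: forbidden_def elim!: oddE)
  then have "int h = 2 * int (m - 1) + 3" by simp
  then show "int h \<in> {2 * int r + 3 | r. 0 \<le> r}" by blast
next
  assume "int h \<in> {2 * int r + 3 | r. 0 \<le> r}"
  then obtain r where "int h = 2 * int r + 3" by auto
  then have "h = 2 * r + 3" by linarith
  then show "forbidden h" by (simp add: forbidden_def)
qed

text \<open>\<open>h\<close> is the starting level and \<open>k\<close> the budget for the initial
  up-run. The left subtree prolongs that run, while the right one follows a \<open>D\<close> and
  gets a fresh budget. The root's \<open>U\<close> makes a peak exactly when the left subtree is
  empty.\<close>

fun good :: "nat \<Rightarrow> nat \<Rightarrow> dtree \<Rightarrow> bool" where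
  "good h k Leaf = True"
| "good h 0 (Node l r) = False"
| "good h (Suc k) (Node l r) \<longleftrightarrow>
     (l = Leaf \<longrightarrow> \<not> forbidden (h + 1)) \<and> good (h + 1) k l \<and> good h 3 r"

lemma short_runs_word_append:
  "short_runs k (word t @ D # v) \<longleftrightarrow> short_runs k (word t) \<and> short_runs 3 v"
proof (induction t arbitrary: k v)
  case Leaf
  show ?case by simp
next
  case (Node l r)
  then show ?case by (cases k) auto
qed

text \<open>No peak straddles the junction, since the word of a tree is empty or ends in
  \<open>D\<close>.\<close>

lemma peaks_word_append:
  "peaks h (word t @ D # v) = peaks h (word t) \<union> peaks (h - 1) v"
proof (induction t arbitrary: h v)
  case Leaf
  show ?case by (simp add: peaks_Cons)
next
  case (Node l r)
  have "hd (word l @ D # w) = D \<longleftrightarrow> l = Leaf" for w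
    by (cases l) auto
  then show ?case by (auto simp: peaks_Cons Node.IH)
qed

lemma peaks_word_Node:
  "peaks h (word (Node l r)) =
     (if l = Leaf then {h + 1} else {}) \<union> peaks (h + 1) (word l) \<union> peaks h (word r)"
proof -
  have "hd (word l @ D # w) = D \<longleftrightarrow> l = Leaf" for w
    by (cases l) auto
  then show ?thesis by (simp add: peaks_Cons peaks_word_append)
qed

lemma good_iff:
  "good h k t \<longleftrightarrow> short_runs k (word t) \<and>
     peaks (int h) (word t) \<inter> {2 * int r + 3 | r. 0 \<le> r} = {}"
proof (induction h k t rule: good.induct)
  case (3 h k l r)
  have eq: "int h + 1 = int (h + 1)" by simp
  have "short_runs (Suc k) (word (Node l r)) \<longleftrightarrow> short_runs k (word l) \<and> short_runs 3 (word r)"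
    by (simp add: short_runs_word_append)
  then show ?case
    unfolding peaks_word_Node good.simps 3 forbidden_iff eq by (auto simp del: of_nat_add)
qed auto

lemma restricted_dyck_paths_eq:
  "{w \<in> dyck_paths n. peak_heights w \<inter> {2 * int r + 3 | r. 0 \<le> r} = {} \<and>
     (\<forall>l \<in> up_run_lengths w. l \<le> 3)} = word ` {t. nodes t = n \<and> good 0 3 t}"
proof -
  define S where "S = {2 * int r + 3 | r. 0 \<le> r}"
  \<comment> \<open>This makes the conventional peak of the empty path harmless.\<close>
  have "0 \<notin> S" using forbidden_iff[of 0] by (simp add: S_def forbidden_def)
  then have "peak_heights (word t) \<inter> S = {} \<longleftrightarrow> peaks 0 (word t) \<inter> S = {}" for t
    unfolding peak_heights_eq by simp
  then have "peak_heights (word t) \<inter> S = {} \<and> (\<forall>l \<in> up_run_lengths (word t). l \<le> 3)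
      \<longleftrightarrow> good 0 3 t" for t
    unfolding up_run_lengths_le_3_iff good_iff S_def[symmetric] of_nat_0 by blast
  then show ?thesis unfolding dyck_paths_eq S_def[symmetric] by blast
qed

text \<open>Periodicity fails at \<open>h = 1\<close>: height 1 is allowed and 3 is not.\<close>

lemma forbidden_add_2: "2 \<le> h \<Longrightarrow> forbidden (h + 2) = forbidden h"
  unfolding forbidden_def by presburger

text \<open>From level 1 or above every peak has height at least 2, where \<open>forbidden\<close>
  is periodic.\<close>

lemma good_add_2: "1 \<le> h \<Longrightarrow> good (h + 2) k t = good h k t"
proof (induction h k t rule: good.induct)
  case (3 h k l r)
  have eq: "h + 2 + 1 = h + 1 + 2" by simp
  have "forbidden (h + 1 + 2) = forbidden (h + 1)"
    using forbidden_add_2[of "h + 1"] "3.prems" by simp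
  moreover have "good (h + 1 + 2) k l = good (h + 1) k l" "good (h + 2) 3 r = good h 3 r"
    using "3.IH" "3.prems" by simp_all
  ultimately show ?case unfolding good.simps eq by blast
qed simp_all

section \<open>Counting\<close>

unbundle fps_syntax

definition good_trees :: "nat \<Rightarrow> nat \<Rightarrow> nat \<Rightarrow> dtree set" where
  "good_trees h k n = {t. nodes t = n \<and> good h k t}"

lemma finite_nodes_le: "finite {t. nodes t \<le> n}"
proof (induction n)
  case 0
  have "{t. nodes t \<le> 0} \<subseteq> {Leaf}"
    by (auto elim: nodes.elims)
  then show ?case by (rule finite_subset) simp
next
  case (Suc n)
  let ?S = "{t. nodes t \<le> n}"
  have "{t. nodes t \<le> Suc n} \<subseteq> insert Leaf ((\<lambda>(l, r). Node l r) ` (?S \<times> ?S))"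
  proof
    fix t assume "t \<in> {t. nodes t \<le> Suc n}"
    then show "t \<in> insert Leaf ((\<lambda>(l, r). Node l r) ` (?S \<times> ?S))"
      by (cases t) auto
  qed
  then show ?case by (rule finite_subset) (simp add: Suc)
qed

lemma finite_good_trees: "finite (good_trees h k n)"
  by (rule finite_subset[OF _ finite_nodes_le[of n]]) (auto simp: good_trees_def)

lemma good_trees_0: "good_trees h k 0 = {Leaf}"
  by (auto simp: good_trees_def elim: nodes.elims)

lemma good_trees_no_run: "good_trees h 0 (Suc n) = {}"
  by (auto simp: good_trees_def elim!: good.elims)

text \<open>Convolution over the size \<open>i\<close> of the left subtree. Removing
  \<open>Leaf\<close> excludes the peak at \<open>h + 1\<close> when that height is
  forbidden.\<close>

lemma card_good_trees_Suc:
  "card (good_trees h (Suc k) (Suc n)) =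
     (\<Sum>i\<le>n. card (good_trees (h + 1) k i - (if forbidden (h + 1) then {Leaf} else {})) *
        card (good_trees h 3 (n - i)))"
proof -
  define A where "A i = good_trees (h + 1) k i - (if forbidden (h + 1) then {Leaf} else {})" for i
  define B where "B i = good_trees h 3 i" for i
  have fin: "finite (A i)" "finite (B i)" for i
    by (simp_all add: A_def B_def finite_good_trees)
  have "good_trees h (Suc k) (Suc n) = (\<lambda>(l, r). Node l r) ` (\<Union>i\<le>n. A i \<times> B (n - i))"
    (is "?L = ?R")
  proof (intro equalityI subsetI)
    fix t assume t: "t \<in> ?L"
    then obtain l r where lr: "t = Node l r"
      by (cases t) (auto simp: good_trees_def)
    then have "(l, r) \<in> A (nodes l) \<times> B (n - nodes l)" "nodes l \<le> n"
      using t by (auto simp: good_trees_def A_def B_def)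
    then show "t \<in> ?R" using lr by blast
  qed (auto simp: good_trees_def A_def B_def split: if_splits)
  moreover have "inj_on (\<lambda>(l, r). Node l r) X" for X
    by (auto simp: inj_on_def)
  ultimately have "card ?L = card (\<Union>i\<le>n. A i \<times> B (n - i))"
    by (simp add: card_image)
  also have "\<dots> = (\<Sum>i\<le>n. card (A i \<times> B (n - i)))"
    by (rule card_UN_disjoint) (use fin in \<open>auto simp: A_def good_trees_def\<close>)
  finally show ?thesis by (simp add: A_def B_def card_cartesian_product)
qed

text \<open>Integer coefficients permit the subtractions below and make the power series an integral
  domain, which allows cancellation.\<close>

definition F :: "nat \<Rightarrow> nat \<Rightarrow> int fps" where
  "F h k = Abs_fps (\<lambda>n. int (card (good_trees h k n)))"

lemma F_0: "F h 0 = 1"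
proof (rule fps_ext)
  fix n
  show "F h 0 $ n = 1 $ n"
    by (cases n) (simp_all add: F_def good_trees_0 good_trees_no_run)
qed

lemma F_Suc:
  "F h (Suc k) = 1 + fps_X * (F (h + 1) k - (if forbidden (h + 1) then 1 else 0)) * F h 3"
proof (rule fps_ext)
  fix n
  let ?c = "if forbidden (h + 1) then 1 else 0 :: int fps"
  \<comment> \<open>\<open>Leaf\<close> is the only tree of size 0, so removing it changes just the
    constant coefficient.\<close>
  have coeff: "(F (h + 1) k - ?c) $ i =
      int (card (good_trees (h + 1) k i - (if forbidden (h + 1) then {Leaf} else {})))" for i
  proof (cases i)
    case 0
    then show ?thesis by (simp add: F_def good_trees_0)
  next
    case (Suc j)
    have "Leaf \<notin> good_trees (h + 1) k (Suc j)" by (simp add: good_trees_def)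
    then show ?thesis using Suc by (simp add: F_def)
  qed
  show "F h (Suc k) $ n = (1 + fps_X * (F (h + 1) k - ?c) * F h 3) $ n"
  proof (cases n)
    case 0
    then show ?thesis by (simp add: F_def good_trees_0)
  next
    case (Suc m)
    have "(fps_X * (F (h + 1) k - ?c) * F h 3) $ Suc m = ((F (h + 1) k - ?c) * F h 3) $ m"
      by (simp only: mult.assoc fps_X_mult_nth) simp
    also have "\<dots> = int (card (good_trees h (Suc k) (Suc m)))"
      unfolding fps_mult_nth coeff card_good_trees_Suc
      by (simp add: F_def atLeast0AtMost)
    finally show ?thesis by (simp add: Suc F_def)
  qed
qed

text \<open>This closes the recursion: only the levels 0, 1 and 2 remain.\<close>

lemma F_3_eq_F_1: "F 3 k = F 1 k"
  using good_add_2[of 1 k] by (simp add: F_def good_trees_def numeral_3_eq_3)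

section \<open>Comparison with the generalized Catalan numbers\<close>

abbreviation G :: "int fps" where
  "G \<equiv> Abs_fps (\<lambda>n. int (gen_catalan n))"

lemma G_eq: "G = 1 + fps_X * G + fps_X * (fps_X * ((G - 1) * G))"
proof (rule fps_ext)
  fix n
  consider "n = 0" | "n = 1" | m where "n = Suc (Suc m)"
    by (metis One_nat_def not0_implies_Suc)
  then show "G $ n = (1 + fps_X * G + fps_X * (fps_X * ((G - 1) * G))) $ n"
  proof cases
    case 3
    \<comment> \<open>The recurrence omits \<open>k = 0\<close> but keeps \<open>k = m\<close>, so
      only the first factor loses its constant term.\<close>
    have "((G - 1) * G) $ m =
        (\<Sum>k = 0..m. (if k = 0 then 0 else int (gen_catalan k * gen_catalan (m - k))))"
      unfolding fps_mult_nth by (rule sum.cong) auto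
    also have "\<dots> = (\<Sum>k\<in>{1..<m+1}. int (gen_catalan k * gen_catalan (m - k)))"
      by (rule sum.mono_neutral_cong_right) auto
    finally show ?thesis using 3 by (simp add: fps_X_mult_nth)
  qed (simp_all add: fps_X_mult_nth)
qed

lemma F_1_3_eq: "F 1 3 = 1 + (fps_X - fps_X\<^sup>2) * F 1 3 + fps_X\<^sup>2 * (F 1 3)\<^sup>2"
  and F_0_3_eq: "F 0 3 = 1 + fps_X * (1 + fps_X * F 1 3) * F 0 3"
proof -
  let ?x = "fps_X :: int fps"
  have allowed: "\<not> forbidden 1" "\<not> forbidden 2" and "forbidden 3"
    by (simp_all add: forbidden_def)
  then have rec:
      "F 0 (Suc k) = 1 + ?x * F 1 k * F 0 3"
      "F 1 (Suc k) = 1 + ?x * F 2 k * F 1 3"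
      "F 2 (Suc k) = 1 + ?x * (F 1 k - 1) * F 2 3" for k
    using F_Suc[of 0 k] F_Suc[of 1 k] F_Suc[of 2 k]
    by (simp_all add: numeral_2_eq_2[symmetric] F_3_eq_F_1)
  \<comment> \<open>An initial run of length 1 from level 2 would peak at 3. Likewise length 2 from
    level 1 peaks at 3 and length 3 from level 2 at 5, hence \<open>F 1 2 = F 1 1\<close> and
    \<open>F 2 3 = F 2 2\<close>.\<close>
  have F21: "F 2 1 = 1" using rec(3)[of 0] by (simp add: F_0)
  have F11: "F 1 1 = 1 + ?x * F 1 3" using rec(2)[of 0] by (simp add: F_0)
  have F12: "F 1 2 = 1 + ?x * F 1 3" using rec(2)[of 1] F21 by (simp add: numeral_2_eq_2)
  have F22: "F 2 2 = 1 + ?x * (?x * F 1 3) * F 2 3"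
    using rec(3)[of 1] F11 by (simp add: numeral_2_eq_2)
  have F23: "F 2 3 = 1 + ?x * (?x * F 1 3) * F 2 3"
    using rec(3)[of 2] F12 by (simp add: numeral_2_eq_2 numeral_3_eq_3)
  have F13: "F 1 3 = 1 + ?x * F 2 3 * F 1 3"
    using rec(2)[of 2] F22 F23 by (simp add: numeral_2_eq_2 numeral_3_eq_3)
  \<comment> \<open>By \<open>F23\<close>, the product of \<open>1 - ?x * ?x * F 1 3\<close> and
    \<open>F 2 3\<close> is 1; multiplying \<open>F13\<close> by this factor eliminates
    \<open>F 2 3\<close>.\<close>
  show "F 1 3 = 1 + (?x - ?x\<^sup>2) * F 1 3 + ?x\<^sup>2 * (F 1 3)\<^sup>2"
    using F13 F23 by algebra
  show "F 0 3 = 1 + ?x * (1 + ?x * F 1 3) * F 0 3"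
    using rec(1)[of 2] F12 by (simp add: numeral_2_eq_2 numeral_3_eq_3)
qed

lemma F_1_3_eq_G: "F 1 3 = G"
proof -
  let ?x = "fps_X :: int fps" and ?Q = "F 1 3"
  \<comment> \<open>\<open>?Q\<close> and \<open>G\<close> satisfy the same quadratic equation. The
    difference of the two instances factors as \<open>(?Q - G) * ?c = 0\<close>.\<close>
  let ?c = "1 - ?x * (1 - ?x + ?x * (?Q + G))"
  have "(?Q - G) * ?c = 0" using F_1_3_eq G_eq by algebra
  moreover have "?c $ 0 = 1" by simp
  then have "?c \<noteq> 0" by (metis fps_zero_nth zero_neq_one)
  ultimately show ?thesis by simp
qed

lemma G_eq_F_0_3: "G = 1 + fps_X * F 0 3"
proof -
  let ?x = "fps_X :: int fps"
  \<comment> \<open>The equation for \<open>F 0 3\<close> reads \<open>F 0 3 * ?c = 1\<close>.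
    Multiplied by \<open>?c\<close>, both \<open>1 + ?x * F 0 3\<close> and \<open>G\<close> become
    \<open>1 - ?x * ?x * G\<close>.\<close>
  let ?c = "1 - ?x * (1 + ?x * G)"
  have "(1 + ?x * F 0 3 - G) * ?c = 0"
    using F_0_3_eq[unfolded F_1_3_eq_G] G_eq by algebra
  moreover have "?c $ 0 = 1" by simp
  then have "?c \<noteq> 0" by (metis fps_zero_nth zero_neq_one)
  ultimately show ?thesis by simp
qed

theorem proposition4:
  fixes n :: nat
  shows "card {w \<in> dyck_paths n.
            peak_heights w \<inter> {2 * int r + 3 | r. 0 \<le> r} = {} \<and>
            (\<forall>l \<in> up_run_lengths w. l \<le> 3)}
         = gen_catalan (n + 1)"
proof -
  \<comment> \<open>The factor \<open>fps_X\<close> shifts the index by one, which accounts for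
    \<open>n + 1\<close>.\<close>
  have "int (gen_catalan (n + 1)) = (1 + fps_X * F 0 3) $ (n + 1)"
    using arg_cong[OF G_eq_F_0_3, of "\<lambda>f. f $ (n + 1)"] by simp
  also have "\<dots> = int (card (good_trees 0 3 n))"
    by (simp add: F_def)
  finally have "card (good_trees 0 3 n) = gen_catalan (n + 1)" by simp
  moreover have "card (word ` good_trees 0 3 n) = card (good_trees 0 3 n)"
    by (rule card_image) (rule inj_on_subset[OF inj_word], simp)
  ultimately show ?thesis
    unfolding restricted_dyck_paths_eq good_trees_def by simp
qed

end
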